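(* For every positive integer $N$, there are at least $N^{1/4}/2-1$ integers $u<N$ for which there exist an integer $t<u$ with $\gcd(t,u)=1$, an integer $\ell\le \frac12\log_2 N$, and $a_1,\ldots,a_\ell\in\{1,2\}$ such that $$\frac{t}{u}=[a_1,1,a_2,1,\ldots,a_\ell,1].$$
   Context: For integers $b_1,\ldots,b_m\ge 1$ ($m\ge 0$), the continued fraction $[b_1,\ldots,b_m]$ is defined as $\cfrac{1}{b_1+\cfrac{1}{\ddots+\frac{1}{b_m}}}$. Here the sequence $[a_1,1,a_2,1,\ldots,a_\ell,1]$ alternates the $a_i$ with entries equal to $1$. Logarithms are base $2$. *)

theory Defs
  imports Complex_Main
begin

text \<open>The continued fraction \<open>[b\<^sub>1, \<dots>, b\<^sub>m]\<close> without integer part.\<close>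

fun cfrac :: "nat list \<Rightarrow> real" where
  "cfrac [] = 0"
| "cfrac (b # bs) = 1 / (real b + cfrac bs)"

definition interleave_ones :: "nat list \<Rightarrow> nat list" where
  "interleave_ones as = concat (map (\<lambda>a. [a, 1]) as)"

end

theory Submission imports Defs begin

text \<open>
  Prepending \<open>a, 1\<close> to a continued fraction with value \<open>t / u\<close> gives the reduced fraction
  \<open>t' / u'\<close> with \<open>t' = t + u\<close> and \<open>u' = a t' + u\<close>. For \<open>a \<le> 2\<close> the quantity \<open>t + u\<close> grows by a
  factor of at most 4, so a length \<open>l\<close> with \<open>4 ^ l \<le> N\<close> keeps the denominators below \<open>N\<close>.
  Moreover \<open>0 < u' - a t' = u \<le> t'\<close>, so \<open>(t', u')\<close> determines \<open>a\<close>, and by descent the whole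
  sequence. For \<open>a = 1\<close> we have \<open>u' = 2 u + t\<close>, hence the two admissible denominators \<open>u'\<close> and
  \<open>u\<close> determine \<open>(t, u)\<close> and thus the tail, for which there are \<open>2 ^ (l - 1)\<close> choices. Therefore the number of admissible denominators has square at least \<open>2 ^ (l - 1)\<close>.
\<close>

fun cfrac_pair :: "nat list \<Rightarrow> nat \<times> nat" where
  "cfrac_pair [] = (0, 1)"
| "cfrac_pair (a # as) = (let (t, u) = cfrac_pair as in (t + u, a * (t + u) + u))"

lemma fst_cfrac_pair_Cons:
  "fst (cfrac_pair (a # as)) = fst (cfrac_pair as) + snd (cfrac_pair as)"
  by (simp add: case_prod_beta)

lemma snd_cfrac_pair_Cons:
  "snd (cfrac_pair (a # as)) = a * (fst (cfrac_pair as) + snd (cfrac_pair as)) + snd (cfrac_pair as)"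
  by (simp add: case_prod_beta)

lemmas cfrac_pair_Cons = fst_cfrac_pair_Cons snd_cfrac_pair_Cons

declare cfrac_pair.simps(2) [simp del]

lemma snd_cfrac_pair_pos: "0 < snd (cfrac_pair as)"
  by (induction as) (auto simp: cfrac_pair_Cons)

lemma fst_cfrac_pair_eq_0_iff: "fst (cfrac_pair as) = 0 \<longleftrightarrow> as = []"
  using snd_cfrac_pair_pos by (cases as) (auto simp: cfrac_pair_Cons)

lemma fst_less_snd_cfrac_pair:
  assumes "0 \<notin> set as"
  shows "fst (cfrac_pair as) < snd (cfrac_pair as)"
proof (cases as)
  case (Cons a bs)
  then have "fst (cfrac_pair as) \<le> a * fst (cfrac_pair as)"
    using assms by auto
  then show ?thesis
    using Cons snd_cfrac_pair_pos[of bs] by (simp only: cfrac_pair_Cons)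
qed simp

lemma coprime_cfrac_pair: "coprime (fst (cfrac_pair as)) (snd (cfrac_pair as))"
proof (induction as)
  case (Cons a as)
  let ?t = "fst (cfrac_pair as)" and ?u = "snd (cfrac_pair as)"
  have "gcd (?t + ?u) (a * (?t + ?u) + ?u) = gcd (?t + ?u) ?u"
    by (rule gcd_add_mult)
  also have "\<dots> = gcd ?t ?u"
    by simp
  finally show ?case
    using Cons by (simp add: cfrac_pair_Cons coprime_iff_gcd_eq_1)
qed simp

lemma cfrac_interleave_ones:
  "cfrac (interleave_ones as) = real (fst (cfrac_pair as)) / real (snd (cfrac_pair as))"
proof (induction as)
  case (Cons a as)
  define t u where "t = real (fst (cfrac_pair as))" and "u = real (snd (cfrac_pair as))"
  have "0 < u" "0 \<le> t"
    using snd_cfrac_pair_pos by (simp_all add: t_def u_def)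
  have "cfrac (interleave_ones (a # as)) = 1 / (real a + 1 / (1 + t / u))"
    using Cons by (simp add: interleave_ones_def t_def u_def)
  also have "1 + t / u = (t + u) / u"
    using \<open>0 < u\<close> by (simp add: field_simps)
  also have "real a + 1 / ((t + u) / u) = (real a * (t + u) + u) / (t + u)"
    using \<open>0 < u\<close> \<open>0 \<le> t\<close> by (subst add_divide_distrib) simp
  finally show ?case
    by (simp add: cfrac_pair_Cons t_def u_def)
qed (simp add: interleave_ones_def)

text \<open>The sum is the quantity that suits the induction: one step replaces \<open>t + u\<close>
  by \<open>(a + 1) * (t + u) + u\<close>, which is at most \<open>4 * (t + u)\<close> when
  \<open>a \<le> 2\<close>.\<close>

lemma cfrac_pair_sum_le:
  assumes "set as \<subseteq> {1, 2}"
  shows "fst (cfrac_pair as) + snd (cfrac_pair as) \<le> 4 ^ length as"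
  using assms by (induction as) (auto simp: cfrac_pair_Cons)

lemma inj_cfrac_pair: "inj cfrac_pair"
proof (rule injI)
  fix as bs assume "cfrac_pair as = cfrac_pair bs"
  then show "as = bs"
  proof (induction as arbitrary: bs)
    case Nil
    then show ?case using fst_cfrac_pair_eq_0_iff[of bs] by (metis cfrac_pair.simps(1) fst_conv)
  next
    case (Cons a as)
    then obtain b bs' where bs: "bs = b # bs'"
      by (metis fst_cfrac_pair_eq_0_iff list.exhaust list.distinct(1))
    define s where "s = fst (cfrac_pair as) + snd (cfrac_pair as)"
    have s: "s = fst (cfrac_pair bs') + snd (cfrac_pair bs')"
      using Cons.prems by (metis bs fst_cfrac_pair_Cons s_def)
    have eq: "a * s + snd (cfrac_pair as) = b * s + snd (cfrac_pair bs')"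
      using Cons.prems by (metis bs snd_cfrac_pair_Cons s_def s)
    \<comment> \<open>Uniqueness of division by \<open>s\<close> with remainders in
      \<open>{1..s}\<close> instead of \<open>{0..<s}\<close>: an empty tail has
      \<open>t = 0\<close>, so its remainder \<open>u\<close> equals \<open>s\<close>.\<close>
    have *: "c \<le> d" if "c * s + x = d * s + y" "0 < x" "y \<le> s" for c d x y :: nat
    proof (rule ccontr)
      assume "\<not> c \<le> d"
      then have "Suc d * s \<le> c * s" by (intro mult_right_mono) auto
      then show False using that by simp
    qed
    have "a \<le> b" "b \<le> a"
      using *[OF eq] *[OF eq[symmetric]] s_def s by (simp_all add: snd_cfrac_pair_pos)
    then have "a = b" by simp
    with eq s s_def have "cfrac_pair as = cfrac_pair bs'" by (simp add: prod_eq_iff)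
    with Cons.IH \<open>a = b\<close> bs show ?case by simp
  qed
qed

lemma inj_consecutive_denominators:
  "inj (\<lambda>as. (snd (cfrac_pair (1 # as)), snd (cfrac_pair as)))"
  by (rule injI) (auto simp: cfrac_pair_Cons prod_eq_iff intro!: injD[OF inj_cfrac_pair])

lemma power4_powr_quarter:
  fixes x :: real
  assumes "0 \<le> x"
  shows "(x ^ 4) powr (1 / 4) = x"
proof (cases "x = 0")
  case False
  then have "x ^ 4 = x powr 4"
    using assms powr_realpow[of x 4] by simp
  then show ?thesis
    using assms by (simp only: powr_powr) simp
qed simp

theorem theorem1p4:
  fixes N :: nat
  assumes "N \<ge> 1"
  shows "real (card {u :: int. 0 < u \<and> u < int N \<and>
            (\<exists>(t :: int) (l :: nat) (as :: nat list).
               t < u \<and> gcd t u = 1 \<and>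
               real l \<le> 1 / 2 * log 2 (real N) \<and>
               length as = l \<and> set as \<subseteq> {1, 2} \<and>
               real_of_int t / real_of_int u = cfrac (interleave_ones as))})
         \<ge> real N powr (1 / 4) / 2 - 1"
    (is "real (card ?S) \<ge> _")
proof (cases "N < 4")
  case True
  \<comment> \<open>For such small \<open>N\<close> the claimed lower bound is at most 0.\<close>
  then have "real N powr (1 / 4) \<le> 16 powr (1 / 4)"
    by (intro powr_mono2) auto
  also have "(16 :: real) powr (1 / 4) = 2"
    using power4_powr_quarter[of 2] by simp
  finally show ?thesis by simp
next
  case False
  \<comment> \<open>\<open>l\<close> is the floor of half the binary logarithm of \<open>N\<close>,
    the largest length allowed.\<close>
  have "\<exists>l. 4 ^ l \<le> N \<and> N < 4 ^ (l + 1)"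
    using ex_power_ivl1[of 4 N] assms by auto
  then obtain l where l: "4 ^ l \<le> N" "N < 4 ^ (l + 1)" by blast
  with False have "l \<noteq> 0" by (intro notI) simp
  then obtain k where k: "l = Suc k" using not0_implies_Suc by blast
  have "finite ?S"
    by (rule finite_subset[of _ "{0..int N}"]) auto
  have mem: "int (snd (cfrac_pair as)) \<in> ?S"
    if as: "set as \<subseteq> {1, 2}" "length as \<le> l" for as
  proof -
    have pow: "(4 :: nat) ^ length as \<le> 4 ^ l"
      using as by (intro power_increasing) auto
    \<comment> \<open>The bound on \<open>t + u\<close> is strict for \<open>u\<close> alone as soon
      as \<open>t > 0\<close>; only the empty list has \<open>t = 0\<close>, and there
      \<open>u = 1 < 4 ^ l\<close>.\<close>
    have "snd (cfrac_pair as) < 4 ^ l"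
    proof (cases "as = []")
      case True
      then show ?thesis using \<open>l \<noteq> 0\<close> one_less_power[of "4 :: nat" l] by simp
    next
      case False
      then show ?thesis
        using cfrac_pair_sum_le[OF as(1)] pow fst_cfrac_pair_eq_0_iff[of as] by linarith
    qed
    then have "snd (cfrac_pair as) < N" using l by simp
    moreover have "real (length as) \<le> 1 / 2 * log 2 (real N)"
    proof -
      have "(2 :: real) ^ (2 * length as) = real (4 ^ length as)"
        by (simp add: power_mult)
      also have "\<dots> \<le> real N" using pow l by (simp only: of_nat_le_iff)
      finally have "real (2 * length as) \<le> log 2 (real N)"
        by (intro le_log_of_power) auto
      then show ?thesis by simp
    qed
    moreover have "int (fst (cfrac_pair as)) < int (snd (cfrac_pair as))"
    proof -
      have "0 \<notin> set as" using as by auto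
      then show ?thesis by (simp add: fst_less_snd_cfrac_pair)
    qed
    moreover have "gcd (int (fst (cfrac_pair as))) (int (snd (cfrac_pair as))) = 1"
      using coprime_cfrac_pair[of as] by (simp add: coprime_iff_gcd_eq_1)
    ultimately show ?thesis
      using snd_cfrac_pair_pos[of as] as cfrac_interleave_ones[of as]
      by (auto intro!: exI[of _ "int (fst (cfrac_pair as))"] exI[of _ as])
  qed
  \<comment> \<open>Length \<open>k = l - 1\<close> leaves room to prepend a 1, so both components
    of \<open>f\<close> are admissible denominators.\<close>
  define L where "L = {as :: nat list. set as \<subseteq> {1, 2} \<and> length as = k}"
  define f where "f = (\<lambda>as. (int (snd (cfrac_pair (1 # as))), int (snd (cfrac_pair as))))"
  have "inj_on f L"
    using inj_consecutive_denominators by (auto simp: inj_on_def f_def)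
  moreover have "f ` L \<subseteq> ?S \<times> ?S"
    using k unfolding f_def L_def by (intro image_subsetI SigmaI mem) auto
  ultimately have "card L \<le> card (?S \<times> ?S)"
    using \<open>finite ?S\<close> by (intro card_inj_on_le finite_cartesian_product)
  moreover have "card L = 2 ^ k"
    using card_lists_length_eq[of "{1, 2 :: nat}" k] by (simp add: L_def numeral_2_eq_2)
  ultimately have card: "2 ^ k \<le> card ?S ^ 2"
    by (simp add: card_cartesian_product power2_eq_square)
  define c where "c = card ?S"
  \<comment> \<open>Here \<open>4 ^ (l + 1) = 4 ^ (k + 2)\<close>; the factor
    \<open>16 = 2 ^ 4\<close> becomes the divisor 2 in the claim after taking fourth roots.\<close>
  have "N \<le> 16 * (2 ^ k) ^ 2"
    using l k by (simp add: power2_eq_square flip: power_mult_distrib)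
  also have "\<dots> \<le> 16 * (c ^ 2) ^ 2"
    using card unfolding c_def by (intro mult_left_mono power_mono) auto
  also have "\<dots> = (2 * c) ^ 4"
    by (simp add: power_mult_distrib flip: power_mult)
  finally have "real N \<le> real (2 * c) ^ 4"
    by (metis of_nat_le_iff of_nat_power)
  then have "real N powr (1 / 4) \<le> (real (2 * c) ^ 4) powr (1 / 4)"
    by (intro powr_mono2) auto
  also have "\<dots> = real (2 * c)"
    by (rule power4_powr_quarter) simp
  finally show ?thesis unfolding c_def by linarith
qed

end
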